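(* Let $1\le k\le n$, $l\ge1$, and $H(\mathbf{x},\mathbf{y})=P(\mathbf{x}\cdot\mathbf{y})$ for $\mathbf{x},\mathbf{y}\in\mathbb{R}^n$, where $P(x)=c_0+c_1x+\dots+c_{l-1}x^{l-1}$ with $c_i\ge0$ for $i=0,\dots,l-1$. Let $\mathbf{x}_1,\dots,\mathbf{x}_N\in\mathbb{R}^n$, let $\mu_{\rm data}$ be the uniform probability measure on $\{\mathbf{x}_i\}_{i=1}^N$, i.e. the measure corresponding to $f(\mathbf{x})=\frac1N\sum_{i=1}^N\delta^n(\mathbf{x}-\mathbf{x}_i)$, and let $\lambda_1\ge\lambda_2\ge\dots\ge\lambda_n$ be the eigenvalues of $H_f$. Let $d_{\rm MMD}$ be the maximum mean discrepancy distance induced by the kernel $K(\mathbf{x},\mathbf{y})=(\mathbf{x}\cdot\mathbf{y})H(\mathbf{x},\mathbf{y})$. Then $$\inf_{\mu\in\mathcal{P}_k}d_{\rm MMD}(\mu_{\rm data},\mu)\ \le\ \sqrt{l}\,\Big(\sum_{i=k+1}^n\lambda_i\Big)^{1/2}.$$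
   Context: $H_f=\frac1{N^2}\sum_{i=1}^N\sum_{j=1}^N\mathbf{x}_i\mathbf{x}_j^TH(\mathbf{x}_i,\mathbf{x}_j)\in\mathbb{R}^{n\times n}$. $\mathcal{P}_k$ is the set of Borel probability measures $\mu$ on $\mathbb{R}^n$ for which there exist $\mathbf{v}_1,\dots,\mathbf{v}_k\in\mathbb{R}^n$ with $\mu(A)=\mu(A\cap\operatorname{span}(\mathbf{v}_1,\dots,\mathbf{v}_k))$ for every Borel set $A$. For a Mercer kernel $K$ with reproducing kernel Hilbert space $\mathcal{H}_K$, the kernel embedding is $\phi(\mu)=\int K(\cdot,\mathbf{y})\,d\mu(\mathbf{y})$ and $d_{\rm MMD}(\mu,\nu)=\|\phi(\mu)-\phi(\nu)\|_{\mathcal{H}_K}$ (for measures for which the embedding is defined). Data points are counted with multiplicity in $\mu_{\rm data}$. *)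

theory Defs
  imports "HOL-Probability.Probability"
begin

definition rkhs_norm ::
  "(('a \<Rightarrow> real) \<Rightarrow> ('a \<Rightarrow> real) \<Rightarrow> real) \<Rightarrow> ('a \<Rightarrow> real) \<Rightarrow> real" where
  "rkhs_norm ip f = sqrt (ip f f)"

text \<open>
  A Hilbert space of functions on \<open>'a\<close>, with carrier \<open>F\<close> and inner product \<open>ip\<close>, that has
  \<open>K\<close> as its reproducing kernel. Nothing is required of \<open>ip\<close> outside \<open>F\<close>.
  By the Moore-Aronszajn theorem every positive semidefinite \<open>K\<close> admits such a pair, and
  \<open>F\<close> as well as the restriction of \<open>ip\<close> to \<open>F\<close> are determined by \<open>K\<close>.
\<close>

locale rkhs =
  fixes K :: "'a \<Rightarrow> 'a \<Rightarrow> real"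
    and F :: "('a \<Rightarrow> real) set"
    and ip :: "('a \<Rightarrow> real) \<Rightarrow> ('a \<Rightarrow> real) \<Rightarrow> real"
  assumes zero_mem: "(\<lambda>x. 0) \<in> F"
    and add_mem: "f \<in> F \<Longrightarrow> g \<in> F \<Longrightarrow> (\<lambda>x. f x + g x) \<in> F"
    and scale_mem: "f \<in> F \<Longrightarrow> (\<lambda>x. a * f x) \<in> F"
    and ip_commute: "f \<in> F \<Longrightarrow> g \<in> F \<Longrightarrow> ip f g = ip g f"
    and ip_add: "f \<in> F \<Longrightarrow> g \<in> F \<Longrightarrow> h \<in> F \<Longrightarrow> ip (\<lambda>x. f x + g x) h = ip f h + ip g h"
    and ip_scale: "f \<in> F \<Longrightarrow> g \<in> F \<Longrightarrow> ip (\<lambda>x. a * f x) g = a * ip f g"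
    and ip_nonneg: "f \<in> F \<Longrightarrow> 0 \<le> ip f f"
    and ip_definite: "f \<in> F \<Longrightarrow> ip f f = 0 \<Longrightarrow> f = (\<lambda>x. 0)"
    and complete: "(\<And>m. s m \<in> F) \<Longrightarrow>
      \<forall>e>0. \<exists>M. \<forall>m\<ge>M. \<forall>m'\<ge>M. rkhs_norm ip (\<lambda>x. s m x - s m' x) < e \<Longrightarrow>
      \<exists>f\<in>F. (\<lambda>m. rkhs_norm ip (\<lambda>x. s m x - f x)) \<longlonglongrightarrow> 0"
    and kernel_mem: "(\<lambda>x. K x y) \<in> F"
    and reproducing: "f \<in> F \<Longrightarrow> ip f (\<lambda>x. K x y) = f y"

text \<open>
  For a continuous kernel, \<open>kernel_embeddable\<close> is Bochner integrability of
  \<open>y \<mapsto> K(\<cdot>, y)\<close> as a map into the Hilbert space. The Bochner integral is then the element of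
  the space whose value at \<open>x\<close> is the scalar integral in \<open>kernel_embedding\<close>, since evaluation
  at a point is a continuous functional.
\<close>

definition kernel_embeddable ::
  "('a \<Rightarrow> 'a \<Rightarrow> real) \<Rightarrow> (('a \<Rightarrow> real) \<Rightarrow> ('a \<Rightarrow> real) \<Rightarrow> real) \<Rightarrow> 'a measure \<Rightarrow> bool" where
  "kernel_embeddable K ip \<mu> \<longleftrightarrow> integrable \<mu> (\<lambda>y. rkhs_norm ip (\<lambda>x. K x y))"

definition kernel_embedding :: "('a \<Rightarrow> 'a \<Rightarrow> real) \<Rightarrow> 'a measure \<Rightarrow> 'a \<Rightarrow> real" where
  "kernel_embedding K \<mu> = (\<lambda>x. \<integral>y. K x y \<partial>\<mu>)"

definition d_MMD ::
  "('a \<Rightarrow> 'a \<Rightarrow> real) \<Rightarrow> (('a \<Rightarrow> real) \<Rightarrow> ('a \<Rightarrow> real) \<Rightarrow> real)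
    \<Rightarrow> 'a measure \<Rightarrow> 'a measure \<Rightarrow> real" where
  "d_MMD K ip \<mu> \<nu> =
     rkhs_norm ip (\<lambda>x. kernel_embedding K \<mu> x - kernel_embedding K \<nu> x)"

definition subspace_measures :: "nat \<Rightarrow> (real^'n) measure set" where
  "subspace_measures k =
     {\<mu>. sets \<mu> = sets borel \<and> prob_space \<mu> \<and>
         (\<exists>v :: nat \<Rightarrow> real^'n. \<forall>A \<in> sets borel.
            emeasure \<mu> A = emeasure \<mu> (A \<inter> span (v ` {1..k})))}"

text \<open>Pushing forward from the indices counts repeated points with multiplicity.\<close>

definition data_measure :: "nat \<Rightarrow> (nat \<Rightarrow> real^'n) \<Rightarrow> (real^'n) measure" where
  "data_measure N x = distr (uniform_count_measure {1..N}) borel x"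

text \<open>
  The library types row and column vectors over an arbitrary one-index type; it has to be pinned
  to \<open>1\<close> for the product to be the outer product.
\<close>

definition H_matrix ::
  "nat \<Rightarrow> (nat \<Rightarrow> real^'n) \<Rightarrow> (real^'n \<Rightarrow> real^'n \<Rightarrow> real) \<Rightarrow> real^'n^'n" where
  "H_matrix N x H = (1 / (real N)\<^sup>2) *\<^sub>R
     (\<Sum>i=1..N. \<Sum>j=1..N. H (x i) (x j) *\<^sub>R ((columnvector (x i) :: real^1^'n) ** rowvector (x j)))"

text \<open>
  \<open>lam 1 \<ge> \<dots> \<ge> lam n\<close> are all the eigenvalues of \<open>A\<close>, repeated according to their multiplicity as
  roots of the characteristic polynomial. Note that \<open>mat t\<close> is \<open>t\<close> times the identity.
\<close>

definition ordered_eigenvalues :: "real^'n^'n \<Rightarrow> (nat \<Rightarrow> real) \<Rightarrow> bool" where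
  "ordered_eigenvalues A lam \<longleftrightarrow>
     antimono_on {1..CARD('n)} lam \<and>
     (\<forall>t. det (mat t - A) = (\<Prod>i=1..CARD('n). t - lam i))"

end

theory Submission
  imports Defs "HOL-Combinatorics.Permutations"
begin

text \<open>
  Let \<open>e\<^sub>1, \<dots>, e\<^sub>n\<close> be an orthonormal basis of eigenvectors of \<open>H\<^sub>f\<close> for the eigenvalues
  \<open>\<lambda>\<^sub>1, \<dots>, \<lambda>\<^sub>n\<close>, and let \<open>\<Pi>\<close> be the orthogonal projection onto the span of the first \<open>k\<close>
  of them. The competitor is the push-forward of the data measure under \<open>\<Pi>\<close>. Put
  \<open>a(u,v) = u \<bullet> v\<close> and \<open>b(u,v) = \<Pi> u \<bullet> \<Pi> v\<close>. Since \<open>\<Pi>\<close> is self-adjoint and idempotent,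
  \<open>u \<bullet> \<Pi> v = b(u,v)\<close> as well, so the cross terms of the squared discrepancy collapse and
  \<open>d\<^sup>2 = (1/N\<^sup>2) \<Sum>\<^sub>i\<^sub>j (a P(a) - b P(b))(x\<^sub>i, x\<^sub>j)\<close>.

  The kernels \<open>a\<close>, \<open>b\<close> and \<open>a - b\<close> are all positive semidefinite, and products of such
  kernels are again of this kind (Schur). Hence \<open>t \<mapsto> t\<^bsup>p+1\<^esup>\<close> lies above its tangent, in the
  ordering of kernels: \<open>a\<^bsup>p+1\<^esup> - b\<^bsup>p+1\<^esup> \<le> (p+1) (a - b) a\<^sup>p\<close>
  (\<open>feature_kernel_power_tangent\<close>). With \<open>p + 1 \<le> l\<close> and nonnegative coefficients this gives
  \<open>a P(a) - b P(b) \<le> l (a - b) P(a)\<close>. Finally \<open>a - b = \<Sum>\<^bsub>r>k\<^esub> (u \<bullet> e\<^sub>r) (v \<bullet> e\<^sub>r)\<close>, so that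
  \<open>(1/N\<^sup>2) \<Sum>\<^sub>i\<^sub>j ((a - b) P(a))(x\<^sub>i, x\<^sub>j) = \<Sum>\<^bsub>r>k\<^esub> e\<^sub>r \<bullet> H\<^sub>f e\<^sub>r = \<Sum>\<^bsub>r>k\<^esub> \<lambda>\<^sub>r\<close>.

  An infimum of reals says something only for a set that is bounded below, which here
  comes from the discrepancy being nonnegative for every competitor. The inner product is known to be nonnegative only
  on the Hilbert space, hence each kernel embedding must be shown to lie in it. As \<open>K\<close> is a
  finite sum \<open>\<Sum> u(x) u(y)\<close>, this reduces to writing the integrals of finitely many functions
  \<open>u\<close> as one finite combination of point evaluations (\<open>integral_as_point_evaluations\<close>):
  every embedding is then a finite combination of the functions \<open>K(\<cdot>, z)\<close>.
\<close>

section \<open>Orthonormal eigenvectors of symmetric matrices\<close>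

text \<open>
  The quadratic form \<open>f x \<bullet> x\<close> attains its maximum on the unit sphere of \<open>S\<close>, and a maximizer
  is an eigenvector. The invariance of \<open>S\<close> makes the gradient of the form at the maximizer an
  admissible direction.
\<close>

lemma self_adjoint_eigenvector_in_subspace:
  fixes f :: "'a::euclidean_space \<Rightarrow> 'a"
  assumes f: "linear f" and adj: "\<And>x y. f x \<bullet> y = x \<bullet> f y"
    and S: "subspace S" "S \<noteq> {0}" and inv: "\<And>x. x \<in> S \<Longrightarrow> f x \<in> S"
  obtains v m where "v \<in> S" "norm v = 1" "f v = m *\<^sub>R v"
proof -
  obtain w where w: "w \<in> S" "w \<noteq> 0"
    using S subspace_0 by blast
  have "compact (sphere 0 1 \<inter> S)"
    using S(1) closed_subspace by (intro compact_Int_closed) auto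
  moreover have "w /\<^sub>R norm w \<in> sphere 0 1 \<inter> S"
    using w S(1) by (auto simp: subspace_scale)
  moreover have "continuous_on (sphere 0 1 \<inter> S) (\<lambda>x. f x \<bullet> x)"
    using f by (intro continuous_intros linear_continuous_on linear_conv_bounded_linear[THEN iffD1])
  ultimately obtain v where v: "v \<in> sphere 0 1 \<inter> S"
    and vmax: "\<And>y. y \<in> sphere 0 1 \<inter> S \<Longrightarrow> f y \<bullet> y \<le> f v \<bullet> v"
    using continuous_attains_sup[of "sphere 0 1 \<inter> S" "\<lambda>x. f x \<bullet> x"] by blast
  define m where "m = f v \<bullet> v"
  have vS: "v \<in> S" and vn: "norm v = 1" using v by auto
  define g where "g y = m *\<^sub>R y - f y" for y
  have gS: "g y \<in> S" if "y \<in> S" for y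
    unfolding g_def using S(1) inv that by (intro subspace_diff subspace_scale)
  have glin: "g (x + t *\<^sub>R y) = g x + t *\<^sub>R g y" for x y t
    unfolding g_def using f by (simp add: linear_add linear_scale algebra_simps)
  have gadj: "g x \<bullet> y = x \<bullet> g y" for x y
    unfolding g_def by (simp add: inner_diff_left inner_diff_right adj)
  have gnonneg: "0 \<le> g y \<bullet> y" if y: "y \<in> S" for y
  proof (cases "y = 0")
    case False
    have "f (y /\<^sub>R norm y) \<bullet> (y /\<^sub>R norm y) \<le> m"
      unfolding m_def using y False S(1) by (intro vmax) (auto simp: subspace_scale)
    then have "(f y \<bullet> y) / (norm y)\<^sup>2 \<le> m"
      using f by (simp add: linear_scale power2_eq_square divide_inverse mult_ac)
    then show ?thesis
      using False by (simp add: g_def inner_diff_left divide_le_eq dot_square_norm)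
  qed simp
  have gv: "g v \<bullet> v = 0"
    using vn by (simp add: g_def inner_diff_left m_def dot_square_norm)
  \<comment> \<open>The quadratic form of \<open>g\<close> is nonnegative on \<open>S\<close> and vanishes at \<open>v\<close>; its value at
    \<open>v - t g v\<close> is \<open>- 2 t b + t\<^sup>2 q\<close>, negative for small \<open>t > 0\<close> unless \<open>b = 0\<close>.\<close>
  define b where "b = g v \<bullet> g v"
  define q where "q = g (g v) \<bullet> g v"
  define t where "t = b / (q + b + 1)"
  have b0: "0 \<le> b" and q0: "0 \<le> q"
    unfolding b_def q_def using gnonneg gS vS by auto
  have "0 \<le> g (v + (-t) *\<^sub>R g v) \<bullet> (v + (-t) *\<^sub>R g v)"
    using vS gS S(1) by (intro gnonneg subspace_add subspace_scale) auto
  also have "\<dots> = - 2 * t * b + t\<^sup>2 * q"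
    unfolding glin using gv gadj[of "g v" v]
    by (simp add: b_def q_def inner_add_left inner_add_right inner_diff_left inner_diff_right
        power2_eq_square algebra_simps)
  finally have "2 * t * b \<le> t\<^sup>2 * q" by simp
  also have "t\<^sup>2 * q \<le> t * b"
  proof -
    have "t * q \<le> b"
      unfolding t_def using b0 q0 by (simp add: divide_le_eq algebra_simps)
    then show ?thesis
      using b0 q0 mult_left_mono[of "t * q" b t] by (simp add: power2_eq_square t_def mult_ac)
  qed
  finally have "t * b \<le> 0" by linarith
  then have "b = 0"
    using b0 q0 by (auto simp: t_def divide_le_0_iff mult_le_0_iff)
  then have "f v = m *\<^sub>R v" by (simp add: b_def g_def)
  with vS vn show thesis by (rule that)
qed

definition orthonormal_eigenvectors ::
  "('a::real_inner \<Rightarrow> 'a) \<Rightarrow> nat set \<Rightarrow> (nat \<Rightarrow> 'a) \<Rightarrow> (nat \<Rightarrow> real) \<Rightarrow> bool"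
  where "orthonormal_eigenvectors f I e m \<longleftrightarrow>
    (\<forall>i\<in>I. \<forall>j\<in>I. e i \<bullet> e j = of_bool (i = j)) \<and> (\<forall>i\<in>I. f (e i) = m i *\<^sub>R e i)"

text \<open>
  The spectral theorem. The orthogonal complement of the eigenvectors already found is invariant,
  because \<open>f\<close> is self-adjoint, so a further eigenvector can be taken from it.
\<close>

lemma self_adjoint_orthonormal_eigenvectors:
  fixes f :: "'a::euclidean_space \<Rightarrow> 'a"
  assumes f: "linear f" and adj: "\<And>x y. f x \<bullet> y = x \<bullet> f y"
  shows "\<exists>e m. orthonormal_eigenvectors f {1..DIM('a)} e m"
proof -
  have "\<exists>e m. orthonormal_eigenvectors f {1..r} e m" if "r \<le> DIM('a)" for r
    using that
  proof (induction r)
    case 0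
    then show ?case by (simp add: orthonormal_eigenvectors_def)
  next
    case (Suc r)
    then obtain e m where em: "orthonormal_eigenvectors f {1..r} e m" by auto
    define S where "S = {y. \<forall>i\<in>{1..r}. e i \<bullet> y = 0}"
    have sub: "subspace S"
      by (auto simp: S_def subspace_def inner_add_right)
    have inv: "f y \<in> S" if "y \<in> S" for y
      using that em by (auto simp: S_def orthonormal_eigenvectors_def adj[symmetric])
    have "dim (e ` {1..r}) \<le> card (e ` {1..r})"
      by (intro dim_le_card') auto
    also have "\<dots> \<le> r" using card_image_le[of "{1..r}" e] by simp
    also have "\<dots> < DIM('a)" using Suc.prems by simp
    finally obtain w where w: "w \<noteq> 0" "\<And>y. y \<in> span (e ` {1..r}) \<Longrightarrow> orthogonal w y"
      by (rule orthogonal_to_subspace_exists) blast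
    have "w \<in> S"
      unfolding S_def using w(2)[OF span_base] by (auto simp: orthogonal_def inner_commute[of w])
    with w(1) have "S \<noteq> {0}" by auto
    then obtain v l where v: "v \<in> S" "norm v = 1" "f v = l *\<^sub>R v"
      using self_adjoint_eigenvector_in_subspace[OF f adj sub _ inv] by metis
    have "e i \<bullet> v = 0" "v \<bullet> e i = 0" if "i \<in> {1..r}" for i
      using v(1) that by (auto simp: S_def inner_commute)
    moreover have "v \<bullet> v = 1"
      using v(2) by (simp add: norm_eq_1)
    ultimately have "orthonormal_eigenvectors f (insert (Suc r) {1..r}) (e(Suc r := v)) (m(Suc r := l))"
      using em v(3) unfolding orthonormal_eigenvectors_def by auto
    then have "orthonormal_eigenvectors f {1..Suc r} (e(Suc r := v)) (m(Suc r := l))"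
      by (simp add: atLeastAtMostSuc_conv)
    then show ?case by blast
  qed
  then show ?thesis by blast
qed

text \<open>
  The eigenvalues are numbered by \<open>{1..n}\<close>, whereas rows of a matrix are indexed by the type \<open>'n\<close>;
  the bijection \<open>h\<close> translates between the two.
\<close>

lemma orthonormal_family_as_matrix:
  fixes e :: "nat \<Rightarrow> real^'n"
  assumes e: "\<And>i j. i \<in> {1..CARD('n)} \<Longrightarrow> j \<in> {1..CARD('n)} \<Longrightarrow> e i \<bullet> e j = of_bool (i = j)"
  obtains h and Q :: "real^'n^'n"
  where "bij_betw h UNIV {1..CARD('n)}" "\<And>i. Q $ i = e (h i)" "Q ** transpose Q = mat 1"
proof -
  obtain h :: "'n \<Rightarrow> nat" where h: "bij_betw h UNIV {1..CARD('n)}"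
    by (metis card_atLeastAtMost diff_Suc_1 finite_atLeastAtMost finite finite_same_card_bij)
  have hI: "h i \<in> {1..CARD('n)}" for i using h by (auto simp: bij_betw_def)
  have hinj: "h i = h j \<longleftrightarrow> i = j" for i j using h by (auto simp: bij_betw_def inj_def)
  have "(\<Sum>r\<in>UNIV. e (h i) $ r * e (h j) $ r) = of_bool (i = j)" for i j
    using e[OF hI hI, of i j] by (simp add: inner_vec_def hinj)
  then have "(\<chi> i. e (h i)) ** transpose (\<chi> i. e (h i)) = mat 1"
    by (simp add: vec_eq_iff matrix_matrix_mult_def transpose_def mat_def)
  with h show thesis by (intro that[of h "\<chi> i. e (h i)"]) auto
qed

lemma orthonormal_expansion_inner:
  fixes e :: "nat \<Rightarrow> real^'n"
  assumes e: "\<And>i j. i \<in> {1..CARD('n)} \<Longrightarrow> j \<in> {1..CARD('n)} \<Longrightarrow> e i \<bullet> e j = of_bool (i = j)"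
  shows "x \<bullet> y = (\<Sum>i\<in>{1..CARD('n)}. (x \<bullet> e i) * (y \<bullet> e i))"
proof -
  obtain h and Q :: "real^'n^'n" where h: "bij_betw h UNIV {1..CARD('n)}"
    and Q: "\<And>i. Q $ i = e (h i)" and QQ: "Q ** transpose Q = mat 1"
    using orthonormal_family_as_matrix[of e] e by metis
  from QQ have "transpose Q ** Q = mat 1" by (simp add: matrix_left_right_inverse)
  then have "x \<bullet> y = x \<bullet> ((transpose Q ** Q) *v y)" by simp
  also have "\<dots> = (Q *v x) \<bullet> (Q *v y)"
    by (metis dot_lmul_matrix matrix_vector_mul_assoc vector_transpose_matrix transpose_transpose)
  also have "\<dots> = (\<Sum>i\<in>UNIV. (x \<bullet> e (h i)) * (y \<bullet> e (h i)))"
    by (simp add: inner_vec_def[of "Q *v x"] matrix_vector_mul_component Q inner_commute)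
  also have "\<dots> = (\<Sum>i\<in>{1..CARD('n)}. (x \<bullet> e i) * (y \<bullet> e i))"
    by (rule sum.reindex_bij_betw[OF h])
  finally show ?thesis .
qed

text \<open>
  Conjugation by the orthogonal matrix of the eigenvectors turns \<open>t - A\<close> into the diagonal matrix
  with entries \<open>t - m i\<close>.
\<close>

lemma charpoly_orthonormal_eigenvectors:
  fixes A :: "real^'n^'n"
  assumes "orthonormal_eigenvectors ((*v) A) {1..CARD('n)} e m"
  shows "det (mat t - A) = (\<Prod>i=1..CARD('n). t - m i)"
proof -
  have e: "e i \<bullet> e j = of_bool (i = j)" and A: "A *v e i = m i *\<^sub>R e i"
    if "i \<in> {1..CARD('n)}" "j \<in> {1..CARD('n)}" for i j
    using assms that by (auto simp: orthonormal_eigenvectors_def)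
  obtain h and Q :: "real^'n^'n" where h: "bij_betw h UNIV {1..CARD('n)}"
    and Q: "\<And>i. Q $ i = e (h i)" and QQ: "Q ** transpose Q = mat 1"
    using orthonormal_family_as_matrix[of e] e by metis
  have hI: "h i \<in> {1..CARD('n)}" for i using h by (auto simp: bij_betw_def)
  have hinj: "h i = h j \<longleftrightarrow> i = j" for i j using h by (auto simp: bij_betw_def inj_def)
  define D where "D = Q ** (mat t - A) ** transpose Q"
  have D: "D $ i $ j = (if i = j then t - m (h i) else 0)" for i j
  proof -
    have "D $ i $ j = (D *v axis j 1) $ i"
      by (simp add: matrix_vector_mult_basis column_def)
    also have "\<dots> = (Q *v ((mat t - A) *v (transpose Q *v axis j 1))) $ i"
      by (simp only: D_def matrix_vector_mul_assoc matrix_mul_assoc)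
    also have "transpose Q *v axis j 1 = e (h j)"
      by (simp add: matrix_vector_mult_basis column_def vec_eq_iff transpose_def Q)
    also have "(mat t - A) *v e (h j) = (t - m (h j)) *\<^sub>R e (h j)"
    proof -
      have "mat t *v e (h j) = t *\<^sub>R e (h j)"
        by (simp add: vec_eq_iff matrix_vector_mult_def mat_def if_distrib[of "\<lambda>z. z * _"] cong: if_cong)
      then show ?thesis
        using A[OF hI hI] by (simp add: matrix_vector_mult_diff_rdistrib scaleR_diff_left)
    qed
    finally show ?thesis
      by (simp add: matrix_vector_mul_component Q e[OF hI hI] hinj)
  qed
  have "det (mat t - A) = det (mat t - A) * det (Q ** transpose Q)" by (simp add: QQ)
  also have "\<dots> = det D" by (simp add: D_def det_mul)
  also have "\<dots> = (\<Prod>i\<in>UNIV. t - m (h i))"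
    by (subst det_diagonal) (auto simp: D)
  also have "\<dots> = (\<Prod>i=1..CARD('n). t - m i)"
    by (rule prod.reindex_bij_betw[OF h])
  finally show ?thesis .
qed

lemma split_polynomial_roots_permute:
  fixes f g :: "'i \<Rightarrow> real"
  assumes I: "finite I" and eq: "\<And>t. (\<Prod>i\<in>I. t - f i) = (\<Prod>i\<in>I. t - g i)"
  obtains p where "p permutes I" "\<forall>i\<in>I. f i = g (p i)"
proof -
  define pol where "pol f = (\<Prod>i\<in>I. [:- f i, 1:])" for f :: "'i \<Rightarrow> real"
  have roots: "proots (pol f) = image_mset f (mset_set I)" for f
    using I unfolding pol_def
    by (subst proots_prod) (simp_all add: sum_unfold_sum_mset)
  have "poly (pol f) = poly (pol g)"
    using eq by (auto simp: pol_def poly_prod)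
  then have "pol f = pol g" by (simp add: poly_eq_poly_eq_iff)
  then have "image_mset f (mset_set I) = image_mset g (mset_set I)"
    by (metis roots)
  with I show thesis by (rule image_mset_eq_implies_permutes) (rule that)
qed

text \<open>
  The eigenvalues of an eigenbasis and the numbers \<open>lam i\<close> are the roots of the same polynomial,
  so they agree up to a permutation, by which the basis is renumbered.
\<close>

lemma eigenbasis_with_given_order:
  fixes A :: "real^'n^'n"
  assumes sym: "transpose A = A"
    and lam: "\<And>t. det (mat t - A) = (\<Prod>i=1..CARD('n). t - lam i)"
  obtains e where "orthonormal_eigenvectors ((*v) A) {1..CARD('n)} e lam"
proof -
  have "(A *v x) \<bullet> y = x \<bullet> (A *v y)" for x y
    by (metis sym dot_lmul_matrix vector_transpose_matrix)
  then obtain e m where em: "orthonormal_eigenvectors ((*v) A) {1..CARD('n)} e m"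
    using self_adjoint_orthonormal_eigenvectors[of "(*v) A"] by auto
  have "(\<Prod>i=1..CARD('n). t - lam i) = (\<Prod>i=1..CARD('n). t - m i)" for t
    using lam charpoly_orthonormal_eigenvectors[OF em] by metis
  then obtain p where p: "p permutes {1..CARD('n)}" "\<forall>i\<in>{1..CARD('n)}. lam i = m (p i)"
    by (rule split_polynomial_roots_permute[OF finite_atLeastAtMost])
  have pI: "p i \<in> {1..CARD('n)}" if "i \<in> {1..CARD('n)}" for i
    using that permutes_in_image[OF p(1)] by blast
  have "p i = p j \<longleftrightarrow> i = j" for i j
    using permutes_inj[OF p(1)] by (rule inj_eq)
  then have "orthonormal_eigenvectors ((*v) A) {1..CARD('n)} (e \<circ> p) lam"
    using em p(2) pI unfolding orthonormal_eigenvectors_def o_def by simp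
  then show thesis by (rule that)
qed

section \<open>Kernels with finitely many features\<close>

text \<open>
  Kernels given by finitely many continuous features, \<open>K x y = \<Sum> u x * u y\<close>. Every positive
  semidefinite kernel that occurs in the proof is of this form, and it makes closure under
  products immediate, whereas for positive semidefiniteness itself that is the Schur product
  theorem. The finite number of features also makes the Hilbert space finite-dimensional.
\<close>

inductive feature_kernel :: "('a::topological_space \<Rightarrow> 'a \<Rightarrow> real) \<Rightarrow> bool" where
  zero: "feature_kernel (\<lambda>x y. 0)"
| insert: "feature_kernel (\<lambda>x y. u x * u y + K x y)"
    if "continuous_on UNIV u" "feature_kernel K"

lemma feature_kernel_rank_one:
  "continuous_on UNIV u \<Longrightarrow> feature_kernel (\<lambda>x y. u x * u y)"
  using feature_kernel.insert[OF _ feature_kernel.zero, of u] by simp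

lemma feature_kernel_add:
  assumes "feature_kernel K" "feature_kernel L"
  shows "feature_kernel (\<lambda>x y. K x y + L x y)"
  using assms by (induction K) (auto simp: add.assoc intro: feature_kernel.insert)

text \<open>
  A product of features is a feature: \<open>(u x * u y) * (v x * v y) = (u v) x * (u v) y\<close>.
\<close>

lemma feature_kernel_rank_one_times:
  assumes "feature_kernel K" and u: "continuous_on UNIV u"
  shows "feature_kernel (\<lambda>x y. u x * u y * K x y)"
  using assms(1)
proof induction
  case zero
  show ?case by (simp add: feature_kernel.zero)
next
  case (insert v K)
  have "feature_kernel (\<lambda>x y. (u x * v x) * (u y * v y) + u x * u y * K x y)"
    using u insert by (intro feature_kernel.insert continuous_intros)
  then show ?case by (simp add: algebra_simps)
qed

lemma feature_kernel_mult:
  assumes "feature_kernel K" "feature_kernel L"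
  shows "feature_kernel (\<lambda>x y. K x y * L x y)"
  using assms(1)
proof induction
  case zero
  show ?case by (simp add: feature_kernel.zero)
next
  case (insert u K)
  show ?case
    using feature_kernel_add[OF feature_kernel_rank_one_times[OF assms(2) insert(1)] insert(3)]
    by (simp add: algebra_simps)
qed

lemma feature_kernel_scale:
  assumes "feature_kernel K" "0 \<le> (r::real)"
  shows "feature_kernel (\<lambda>x y. r * K x y)"
  using feature_kernel_rank_one_times[OF assms(1), of "\<lambda>_. sqrt r"] assms(2) by simp

lemma feature_kernel_sum:
  assumes "finite I" "\<And>i. i \<in> I \<Longrightarrow> feature_kernel (K i)"
  shows "feature_kernel (\<lambda>x y. \<Sum>i\<in>I. K i x y)"
  using assms by (induction I) (auto intro: feature_kernel_add feature_kernel.zero)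

lemma feature_kernel_power:
  assumes "feature_kernel K"
  shows "feature_kernel (\<lambda>x y. K x y ^ p)"
proof (induction p)
  case 0
  show ?case using feature_kernel_rank_one[of "\<lambda>_. 1"] by simp
next
  case (Suc p)
  then show ?case using feature_kernel_mult[OF assms] by simp
qed

text \<open>
  Each feature contributes the square of its sum over the points. This is the only form in which
  positive semidefiniteness is applied: to the vector of ones.
\<close>

lemma feature_kernel_double_sum_nonneg:
  assumes "feature_kernel K"
  shows "0 \<le> (\<Sum>i\<in>I. \<Sum>j\<in>I. K (x i) (x j))"
  using assms
proof induction
  case (insert u K)
  have "(\<Sum>i\<in>I. \<Sum>j\<in>I. u (x i) * u (x j) + K (x i) (x j)) =
      (\<Sum>i\<in>I. u (x i))\<^sup>2 + (\<Sum>i\<in>I. \<Sum>j\<in>I. K (x i) (x j))"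
    by (simp add: sum.distrib power2_eq_square sum_product)
  with insert show ?case by simp
qed simp

lemma feature_kernel_power_diff:
  assumes a: "feature_kernel a" and b: "feature_kernel b"
    and ab: "feature_kernel (\<lambda>x y. a x y - b x y)"
  shows "feature_kernel (\<lambda>x y. a x y ^ p - b x y ^ p)"
proof (induction p)
  case (Suc p)
  have "feature_kernel (\<lambda>x y. a x y * (a x y ^ p - b x y ^ p) + (a x y - b x y) * b x y ^ p)"
    using assms Suc by (intro feature_kernel_add feature_kernel_mult feature_kernel_power)
  then show ?case by (simp add: algebra_simps)
qed (simp add: feature_kernel.zero)

text \<open>
  The kernel version of the tangent inequality \<open>t\<^bsup>p+1\<^esup> - s\<^bsup>p+1\<^esup> \<le> (p+1) (t - s) t\<^sup>p\<close>. Writing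
  \<open>T\<^sub>p\<close> for the right side minus the left side at \<open>t = a\<close>, \<open>s = b\<close>, one has
  \<open>T\<^bsub>p+1\<^esub> = a T\<^sub>p + (a - b) (a\<^bsup>p+1\<^esup> - b\<^bsup>p+1\<^esup>)\<close>, and all factors on the right are feature kernels.
\<close>

lemma feature_kernel_power_tangent:
  assumes a: "feature_kernel a" and b: "feature_kernel b"
    and ab: "feature_kernel (\<lambda>x y. a x y - b x y)"
  shows "feature_kernel (\<lambda>x y. real (Suc p) * (a x y - b x y) * a x y ^ p
           - (a x y ^ Suc p - b x y ^ Suc p))"
proof (induction p)
  case (Suc p)
  have "feature_kernel (\<lambda>x y. a x y * (real (Suc p) * (a x y - b x y) * a x y ^ p
           - (a x y ^ Suc p - b x y ^ Suc p)) + (a x y - b x y) * (a x y ^ Suc p - b x y ^ Suc p))"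
    using assms Suc by (intro feature_kernel_add feature_kernel_mult feature_kernel_power_diff)
  then show ?case by (simp add: algebra_simps)
qed (simp add: feature_kernel.zero)

text \<open>
  For the \<open>i\<close>-th monomial the tangent inequality has the factor \<open>i + 1 \<le> l\<close>. The surplus
  \<open>l - (i + 1)\<close> multiplies the feature kernel \<open>(a - b) a\<^sup>i\<close>, so a common factor \<open>l\<close> is possible.
\<close>

lemma feature_kernel_polynomial_tangent:
  fixes c :: "nat \<Rightarrow> real"
  assumes a: "feature_kernel a" and b: "feature_kernel b"
    and ab: "feature_kernel (\<lambda>x y. a x y - b x y)"
    and c: "\<And>i. i < l \<Longrightarrow> 0 \<le> c i"
  shows "feature_kernel (\<lambda>x y. real l * ((a x y - b x y) * (\<Sum>i<l. c i * a x y ^ i))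
     - (a x y * (\<Sum>i<l. c i * a x y ^ i) - b x y * (\<Sum>i<l. c i * b x y ^ i)))"
proof -
  have "feature_kernel (\<lambda>x y. \<Sum>i<l. c i * (
      (real (Suc i) * (a x y - b x y) * a x y ^ i - (a x y ^ Suc i - b x y ^ Suc i))
      + real (l - Suc i) * ((a x y - b x y) * a x y ^ i)))"
    using c by (intro feature_kernel_sum feature_kernel_scale feature_kernel_add
        feature_kernel_power_tangent feature_kernel_mult feature_kernel_power a b ab) auto
  also have "(\<lambda>x y. \<Sum>i<l. c i * (
      (real (Suc i) * (a x y - b x y) * a x y ^ i - (a x y ^ Suc i - b x y ^ Suc i))
      + real (l - Suc i) * ((a x y - b x y) * a x y ^ i))) =
    (\<lambda>x y. \<Sum>i<l. real l * ((a x y - b x y) * (c i * a x y ^ i))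
     - (a x y * (c i * a x y ^ i) - b x y * (c i * b x y ^ i)))"
    by (intro ext sum.cong refl) (auto simp: of_nat_diff algebra_simps)
  finally show ?thesis
    by (simp add: sum_subtractf sum_distrib_left)
qed

section \<open>Embeddings into the reproducing kernel Hilbert space\<close>

lemma feature_kernel_features:
  assumes "feature_kernel K"
  obtains us where "\<And>u. u \<in> set us \<Longrightarrow> continuous_on UNIV u"
    and "\<And>x y. K x y = (\<Sum>u\<leftarrow>us. u x * u y)"
proof -
  have "\<exists>us. (\<forall>u\<in>set us. continuous_on UNIV u) \<and> (\<forall>x y. K x y = (\<Sum>u\<leftarrow>us. u x * u y))"
    using assms
  proof induction
    case zero
    show ?case by (rule exI[of _ "[]"]) simp
  next
    case (insert u K)
    then obtain us where "\<forall>u\<in>set us. continuous_on UNIV u" "\<forall>x y. K x y = (\<Sum>u\<leftarrow>us. u x * u y)"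
      by blast
    with insert(1) show ?case by (intro exI[of _ "u # us"]) simp
  qed
  then show thesis using that by blast
qed

text \<open>
  Gaussian elimination: after choosing a point \<open>w\<close> where the first function \<open>v\<close> does not vanish,
  each other function \<open>u\<close> is replaced by \<open>u - (u w / v w) v\<close>, which vanishes at \<open>w\<close>. A formula
  for the reduced functions becomes one for all of them by adding \<open>w\<close> as a further point.
  The points and weights are common to all functions of the list.
\<close>

lemma integral_as_point_evaluations:
  fixes us :: "('a \<Rightarrow> real) list"
  assumes "\<And>u. u \<in> set us \<Longrightarrow> integrable \<mu> u"
  shows "\<exists>(n::nat) b z. \<forall>u\<in>set us. (\<integral>y. u y \<partial>\<mu>) = (\<Sum>i<n. b i * u (z i))"
  using assms
proof (induction "length us" arbitrary: us)
  case 0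
  then show ?case by simp
next
  case (Suc r)
  then obtain v vs where us: "us = v # vs" by (cases us) auto
  have v: "integrable \<mu> v" and vs: "\<And>u. u \<in> set vs \<Longrightarrow> integrable \<mu> u"
    using Suc.prems us by auto
  show ?case
  proof (cases "\<exists>w. v w \<noteq> 0")
    case False
    then have "v = (\<lambda>_. 0)" by auto
    moreover have "\<exists>n b z. \<forall>u\<in>set vs. (\<integral>y. u y \<partial>\<mu>) = (\<Sum>i<(n::nat). b i * u (z i))"
      using Suc.hyps us vs by (intro Suc.hyps(1)) auto
    ultimately show ?thesis by (simp add: us)
  next
    case True
    then obtain w where w: "v w \<noteq> 0" by blast
    define elim where "elim u = (\<lambda>y. u y - u w / v w * v y)" for u
    have "\<exists>n b z. \<forall>u\<in>set (map elim vs). (\<integral>y. u y \<partial>\<mu>) = (\<Sum>i<(n::nat). b i * u (z i))"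
      using Suc.hyps(2) us v vs by (intro Suc.hyps(1)) (auto simp: elim_def)
    then obtain n b z where nbz:
      "\<And>u. u \<in> set vs \<Longrightarrow> (\<integral>y. elim u y \<partial>\<mu>) = (\<Sum>i<(n::nat). b i * elim u (z i))"
      by auto
    \<comment> \<open>The weight at the pivot point \<open>w\<close> is chosen to make the formula exact for \<open>v\<close>.\<close>
    define d where "d = (\<integral>y. v y \<partial>\<mu>) - (\<Sum>i<n. b i * v (z i))"
    define b' where "b' = b(n := d / v w)"
    define z' where "z' = z(n := w)"
    have split: "(\<Sum>i<Suc n. b' i * u (z' i)) = (\<Sum>i<n. b i * u (z i)) + d / v w * u w" for u
    proof -
      have "(\<Sum>i<n. b' i * u (z' i)) = (\<Sum>i<n. b i * u (z i))"
        by (rule sum.cong) (auto simp: b'_def z'_def)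
      then show ?thesis by (simp add: b'_def z'_def)
    qed
    have "(\<integral>y. u y \<partial>\<mu>) = (\<Sum>i<Suc n. b' i * u (z' i))" if u: "u \<in> set us" for u
    proof (cases "u = v")
      case True
      then show ?thesis unfolding split using w by (simp add: d_def)
    next
      case False
      with u us have uvs: "u \<in> set vs" by auto
      have "(\<integral>y. u y \<partial>\<mu>) - u w / v w * (\<integral>y. v y \<partial>\<mu>) = (\<integral>y. elim u y \<partial>\<mu>)"
        unfolding elim_def using v vs[OF uvs] by simp
      also have "\<dots> = (\<Sum>i<n. b i * u (z i)) - u w / v w * (\<Sum>i<n. b i * v (z i))"
        unfolding nbz[OF uvs] by (simp add: elim_def right_diff_distrib sum_subtractf
            sum_distrib_left mult_ac)
      finally show ?thesis unfolding split by (simp add: d_def field_simps w)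
    qed
    then show ?thesis by blast
  qed
qed

context rkhs
begin

lemma kernel_combination:
  assumes "finite I"
  shows "(\<lambda>x. \<Sum>i\<in>I. b i * K x (z i)) \<in> F"
    and "g \<in> F \<Longrightarrow> ip (\<lambda>x. \<Sum>i\<in>I. b i * K x (z i)) g = (\<Sum>i\<in>I. b i * g (z i))"
proof -
  have "(\<lambda>x. \<Sum>i\<in>I. b i * K x (z i)) \<in> F \<and>
      (g \<in> F \<longrightarrow> ip (\<lambda>x. \<Sum>i\<in>I. b i * K x (z i)) g = (\<Sum>i\<in>I. b i * g (z i)))"
    using assms
  proof (induction I)
    case empty
    have "ip (\<lambda>x. 0 * 0) g = 0 * ip (\<lambda>x. 0) g" if "g \<in> F"
      using that zero_mem by (intro ip_scale)
    then show ?case using zero_mem by simp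
  next
    case (insert i I)
    have "ip (\<lambda>x. b i * K x (z i)) g = b i * g (z i)" if "g \<in> F"
      using that kernel_mem by (simp add: ip_scale ip_commute[of _ g] reproducing)
    then show ?case
      using insert kernel_mem by (auto simp: add_mem scale_mem ip_add)
  qed
  then show "(\<lambda>x. \<Sum>i\<in>I. b i * K x (z i)) \<in> F"
    and "g \<in> F \<Longrightarrow> ip (\<lambda>x. \<Sum>i\<in>I. b i * K x (z i)) g = (\<Sum>i\<in>I. b i * g (z i))"
    by auto
qed

lemma rkhs_norm_kernel: "rkhs_norm ip (\<lambda>x. K x y) = sqrt (K y y)"
  by (simp add: rkhs_norm_def reproducing kernel_mem)

lemma diff_mem: "f \<in> F \<Longrightarrow> g \<in> F \<Longrightarrow> (\<lambda>x. f x - g x) \<in> F"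
  using add_mem[of f "\<lambda>x. (-1) * g x"] scale_mem[of g "-1"] by simp

lemma ip_diff:
  assumes "f \<in> F" "g \<in> F" "h \<in> F"
  shows "ip (\<lambda>x. f x - g x) h = ip f h - ip g h"
  using assms ip_add[of f "\<lambda>x. (-1) * g x" h] scale_mem[of g "-1"] ip_scale[of g h "-1"] by simp

end

text \<open>
  The features satisfy \<open>(u y)\<^sup>2 \<le> K y y = \<parallel>K(\<cdot>, y)\<parallel>\<^sup>2\<close>, so embeddability makes them integrable. Their
  integrals are common combinations of point values, which turns the embedding into a finite
  combination of functions \<open>K(\<cdot>, z)\<close>.
\<close>

lemma kernel_embedding_mem:
  fixes K :: "'a::topological_space \<Rightarrow> 'a \<Rightarrow> real"
  assumes rk: "rkhs K F ip" and fk: "feature_kernel K"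
    and sets: "sets \<mu> = sets borel" and emb: "kernel_embeddable K ip \<mu>"
  shows "kernel_embedding K \<mu> \<in> F"
proof -
  interpret rkhs K F ip by (rule rk)
  obtain us where cont: "\<And>u. u \<in> set us \<Longrightarrow> continuous_on UNIV u"
    and K: "\<And>x y. K x y = (\<Sum>u\<leftarrow>us. u x * u y)"
    using feature_kernel_features[OF fk] by blast
  have int: "integrable \<mu> u" if u: "u \<in> set us" for u
  proof (rule Bochner_Integration.integrable_bound)
    show "integrable \<mu> (\<lambda>y. sqrt (K y y))"
      using emb by (simp add: kernel_embeddable_def rkhs_norm_kernel)
    show "u \<in> borel_measurable \<mu>"
      using cont[OF u] sets by (metis borel_measurable_continuous_onI measurable_cong_sets)
    have "u y * u y \<le> K y y" for y
      unfolding K using u by (intro member_le_sum_list) auto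
    then have "\<bar>u y\<bar> \<le> sqrt (K y y)" for y
      by (metis real_sqrt_abs2 real_sqrt_le_mono)
    then show "AE y in \<mu>. norm (u y) \<le> norm (sqrt (K y y))"
      by (intro AE_I2) (simp add: order_trans[OF _ abs_ge_self])
  qed
  obtain n :: nat and b z where nbz:
    "\<And>u. u \<in> set us \<Longrightarrow> (\<integral>y. u y \<partial>\<mu>) = (\<Sum>i<n. b i * u (z i))"
    using integral_as_point_evaluations[OF int] by metis
  have "kernel_embedding K \<mu> x = (\<Sum>i<n. b i * K x (z i))" for x
  proof -
    have sub: "(\<integral>y. (\<Sum>u\<leftarrow>vs. u x * u y) \<partial>\<mu>) = (\<Sum>i<n. b i * (\<Sum>u\<leftarrow>vs. u x * u (z i)))
        \<and> integrable \<mu> (\<lambda>y. \<Sum>u\<leftarrow>vs. u x * u y)"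
      if "set vs \<subseteq> set us" for vs
      using that
    proof (induction vs)
      case (Cons v vs)
      then show ?case
        using int[of v] nbz[of v]
        by (simp add: sum_distrib_left sum.distrib algebra_simps)
    qed simp
    then show ?thesis by (simp add: kernel_embedding_def K)
  qed
  then have "kernel_embedding K \<mu> = (\<lambda>x. \<Sum>i<n. b i * K x (z i))" by auto
  then show ?thesis by (simp add: kernel_combination)
qed

section \<open>Discrepancy of empirical measures\<close>

lemma data_points_measurable:
  "x \<in> measurable (uniform_count_measure {1..N}) (borel :: (real^'n) measure)"
  by (simp add: measurable_def space_uniform_count_measure sets_uniform_count_measure)

lemma data_measure_integral:
  fixes x :: "nat \<Rightarrow> real^'n"
  assumes "g \<in> borel_measurable borel"
  shows "(\<integral>y. g y \<partial>data_measure N x) = (\<Sum>i=1..N. g (x i)) / real N"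
    and "integrable (data_measure N x) g"
proof -
  note [measurable] = data_points_measurable
  show "(\<integral>y. g y \<partial>data_measure N x) = (\<Sum>i=1..N. g (x i)) / real N"
    using assms unfolding data_measure_def
    by (simp add: integral_distr integral_uniform_count_measure del: One_nat_def)
  show "integrable (data_measure N x) g"
    using assms unfolding data_measure_def
    by (subst integrable_distr_eq) 
       (auto simp: uniform_count_measure_def integrable_point_measure_finite)
qed

lemma data_measure_subspace:
  fixes x :: "nat \<Rightarrow> real^'n"
  assumes "1 \<le> N" and "\<And>i. x i \<in> span (v ` {1..k})"
  shows "data_measure N x \<in> subspace_measures k"
proof -
  have "prob_space (data_measure N x)"
    unfolding data_measure_def using assms(1)
    by (intro prob_space.prob_space_distr prob_space_uniform_count_measure data_points_measurable) auto
  moreover have "emeasure (data_measure N x) A =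
      emeasure (data_measure N x) (A \<inter> span (v ` {1..k}))" if "A \<in> sets borel" for A
  proof -
    have "span (v ` {1..k}) \<in> sets borel"
      by (intro borel_closed closed_span)
    moreover have "x -` A = x -` (A \<inter> span (v ` {1..k}))"
      using assms(2) by auto
    ultimately show ?thesis
      using that by (simp add: data_measure_def emeasure_distr data_points_measurable del: One_nat_def)
  qed
  moreover have "sets (data_measure N x) = sets borel"
    by (simp add: data_measure_def)
  ultimately show ?thesis
    unfolding subspace_measures_def by blast
qed

lemma d_MMD_data_measures:
  fixes x y :: "nat \<Rightarrow> real^'n"
  assumes rk: "rkhs K F ip" and K: "\<And>u. (\<lambda>v. K u v) \<in> borel_measurable borel"
  shows "d_MMD K ip (data_measure N x) (data_measure N y) =
    sqrt ((\<Sum>i=1..N. \<Sum>j=1..N. K (x i) (x j) - K (x i) (y j) - K (y i) (x j) + K (y i) (y j))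
      / (real N)\<^sup>2)"
proof -
  interpret rkhs K F ip by (rule rk)
  define E where "E w = (\<lambda>u. \<Sum>i=1..N. 1 / real N * K u (w i))" for w :: "nat \<Rightarrow> real^'n"
  have emb: "kernel_embedding K (data_measure N w) = E w" for w :: "nat \<Rightarrow> real^'n"
    by (auto simp: kernel_embedding_def data_measure_integral(1)[OF K] E_def sum_divide_distrib)
  have E: "E w \<in> F" "g \<in> F \<Longrightarrow> ip (E w) g = (\<Sum>i=1..N. 1 / real N * g (w i))" for w g
    unfolding E_def by (simp_all add: kernel_combination del: times_divide_eq_left)
  define f where "f = (\<lambda>u. E x u - E y u)"
  have f: "f \<in> F" unfolding f_def by (intro diff_mem E)
  have "ip f f = ip (E x) f - ip (E y) f"
    using f E(1) by (subst f_def) (rule ip_diff)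
  also have "\<dots> = (\<Sum>i=1..N. f (x i) - f (y i)) / real N"
    using f by (simp add: E(2) sum_subtractf sum_divide_distrib diff_divide_distrib)
  also have "\<dots> = (\<Sum>i=1..N. \<Sum>j=1..N. K (x i) (x j) - K (x i) (y j) - K (y i) (x j) + K (y i) (y j))
      / (real N)\<^sup>2"
    unfolding f_def E_def
    by (simp add: sum_subtractf sum.distrib sum_divide_distrib power2_eq_square
        diff_divide_distrib add_divide_distrib)
  finally show ?thesis
    by (simp add: d_MMD_def emb rkhs_norm_def f_def)
qed

section \<open>The matrix of the data\<close>

lemma outer_product_entry:
  "((columnvector u :: real^1^'n) ** rowvector v) $ p $ q = u $ p * v $ q"
  by (simp add: matrix_matrix_mult_def columnvector_def rowvector_def)

lemma H_matrix_entry: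
  "H_matrix N x H $ p $ q = (\<Sum>i=1..N. \<Sum>j=1..N. H (x i) (x j) * (x i $ p * x j $ q)) / (real N)\<^sup>2"
  by (simp add: H_matrix_def outer_product_entry sum_component)

lemma H_matrix_symmetric:
  assumes "\<And>u v. H u v = H v u"
  shows "transpose (H_matrix N x H) = H_matrix N x H"
proof -
  have "H_matrix N x H $ q $ p = H_matrix N x H $ p $ q" for p q
  proof -
    have "(\<Sum>i=1..N. \<Sum>j=1..N. H (x i) (x j) * (x i $ q * x j $ p)) =
        (\<Sum>i=1..N. \<Sum>j=1..N. H (x j) (x i) * (x j $ q * x i $ p))"
      by (rule sum.swap)
    also have "\<dots> = (\<Sum>i=1..N. \<Sum>j=1..N. H (x i) (x j) * (x i $ p * x j $ q))"
      by (intro sum.cong refl) (metis assms mult.commute)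
    finally show ?thesis by (simp add: H_matrix_entry)
  qed
  then show ?thesis by (simp add: vec_eq_iff transpose_def)
qed

text \<open>
  With \<open>w\<close> a unit eigenvector, the left side is its eigenvalue and the right side the share of
  the direction \<open>w\<close> in \<open>(1/N\<^sup>2) \<Sum>\<^sub>i\<^sub>j (x\<^sub>i \<bullet> x\<^sub>j) H(x\<^sub>i, x\<^sub>j)\<close>.
\<close>

lemma H_matrix_quadratic_form:
  "w \<bullet> (H_matrix N x H *v w) =
     (\<Sum>i=1..N. \<Sum>j=1..N. (x i \<bullet> w) * (x j \<bullet> w) * H (x i) (x j)) / (real N)\<^sup>2"
proof -
  have "w \<bullet> (H_matrix N x H *v w) = (\<Sum>p\<in>UNIV. \<Sum>q\<in>UNIV. w $ p * (H_matrix N x H $ p $ q * w $ q))"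
    by (simp add: inner_vec_def matrix_vector_mult_def sum_distrib_left)
  also have "\<dots> = (\<Sum>p\<in>UNIV. \<Sum>q\<in>UNIV. \<Sum>i=1..N. \<Sum>j=1..N.
      (x i $ p * w $ p) * (x j $ q * w $ q) * H (x i) (x j) / (real N)\<^sup>2)"
    by (simp add: H_matrix_entry sum_distrib_left sum_distrib_right sum_divide_distrib mult_ac)
  also have "\<dots> = (\<Sum>i=1..N. \<Sum>j=1..N. \<Sum>p\<in>UNIV. \<Sum>q\<in>UNIV.
      (x i $ p * w $ p) * (x j $ q * w $ q) * H (x i) (x j) / (real N)\<^sup>2)"
    by (simp only: sum.swap[of _ "{1..N}" UNIV])
  also have "\<dots> = (\<Sum>i=1..N. \<Sum>j=1..N. (x i \<bullet> w) * (x j \<bullet> w) * H (x i) (x j)) / (real N)\<^sup>2"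
    by (simp add: inner_vec_def sum_product flip: sum_distrib_right sum_divide_distrib)
  finally show ?thesis .
qed

section \<open>Projection onto the leading eigenvectors\<close>

theorem theorem10:
  fixes k l N :: nat
    and c :: "nat \<Rightarrow> real"
    and P :: "real \<Rightarrow> real"
    and H K :: "real^'n \<Rightarrow> real^'n \<Rightarrow> real"
    and x :: "nat \<Rightarrow> real^'n"
    and lam :: "nat \<Rightarrow> real"
    and F :: "(real^'n \<Rightarrow> real) set"
    and ip :: "(real^'n \<Rightarrow> real) \<Rightarrow> (real^'n \<Rightarrow> real) \<Rightarrow> real"
  assumes "1 \<le> k" and "k \<le> CARD('n)" and "1 \<le> l" and "1 \<le> N"
    and "\<And>i. i < l \<Longrightarrow> 0 \<le> c i"
    and "\<And>t. P t = (\<Sum>i<l. c i * t ^ i)"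
    and "\<And>u v. H u v = P (u \<bullet> v)"
    and "ordered_eigenvalues (H_matrix N x H) lam"
    and "\<And>u v. K u v = (u \<bullet> v) * H u v"
    and "rkhs K F ip"
  shows "(INF \<mu> \<in> {\<mu> \<in> subspace_measures k. kernel_embeddable K ip \<mu>}.
            d_MMD K ip (data_measure N x) \<mu>)
         \<le> sqrt (real l) * sqrt (\<Sum>i=k+1..CARD('n). lam i)"
proof -
  note k = assms(2) and N = assms(4) and c = assms(5) and P = assms(6) and H = assms(7)
    and ev = assms(8) and K = assms(9) and rk = assms(10)
  interpret rkhs K F ip by (rule rk)
  have "H u v = H v u" for u v by (simp add: H inner_commute)
  then obtain e where e: "orthonormal_eigenvectors ((*v) (H_matrix N x H)) {1..CARD('n)} e lam"
    using eigenbasis_with_given_order[OF H_matrix_symmetric, of H N x lam] ev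
    unfolding ordered_eigenvalues_def by blast
  have orth: "e i \<bullet> e j = of_bool (i = j)" if "i \<in> {1..CARD('n)}" "j \<in> {1..CARD('n)}" for i j
    using e that unfolding orthonormal_eigenvectors_def by blast
  \<comment> \<open>The Gram kernel of the coordinates in \<open>I\<close>: \<open>a\<close> for all indices, \<open>b\<close> for \<open>{1..k}\<close>,
    and \<open>a - b\<close> for the remaining ones.\<close>
  define G where "G I u v = (\<Sum>i\<in>I. (u \<bullet> e i) * (v \<bullet> e i))" for I u v
  have G: "feature_kernel (G I)" if "finite I" for I
    unfolding G_def using that
    by (intro feature_kernel_sum feature_kernel_rank_one continuous_intros)
  have G_commute: "G I u v = G I v u" for I u v
    by (simp add: G_def mult.commute)
  have inner_G: "u \<bullet> v = G {1..CARD('n)} u v" for u v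
    unfolding G_def by (rule orthonormal_expansion_inner[OF orth])
  have G_split: "u \<bullet> v - G {1..k} u v = G {k+1..CARD('n)} u v" for u v
  proof -
    have "{1..CARD('n)} = {1..k} \<union> {k+1..CARD('n)}" using k by auto
    then show ?thesis unfolding inner_G by (simp add: G_def sum.union_disjoint)
  qed
  define proj where "proj u = (\<Sum>i\<in>{1..k}. (u \<bullet> e i) *\<^sub>R e i)" for u
  have proj_inner: "proj u \<bullet> v = G {1..k} u v" for u v
    by (simp add: proj_def G_def inner_sum_left inner_commute[of v])
  have "proj u \<bullet> e i = u \<bullet> e i" if "i \<in> {1..k}" for u i
  proof -
    have "proj u \<bullet> e i = (\<Sum>j\<in>{1..k}. if j = i then u \<bullet> e i else 0)"
      unfolding proj_def inner_sum_left
      using k that by (intro sum.cong) (auto simp: orth)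
    with that show ?thesis by simp
  qed
  then have G_proj: "G {1..k} (proj u) v = G {1..k} u v" "G {1..k} u (proj v) = G {1..k} u v" for u v
    unfolding G_def by simp_all
  have inner_proj: "u \<bullet> proj v = G {1..k} u v" "proj u \<bullet> proj v = G {1..k} u v" for u v
    by (metis inner_commute proj_inner G_commute, simp only: proj_inner G_proj)
  have fk: "feature_kernel K"
  proof -
    have "feature_kernel (\<lambda>u v. G {1..CARD('n)} u v * (\<Sum>i<l. c i * G {1..CARD('n)} u v ^ i))"
      using c by (intro feature_kernel_mult feature_kernel_sum feature_kernel_scale
          feature_kernel_power G) auto
    also have "(\<lambda>u v. G {1..CARD('n)} u v * (\<Sum>i<l. c i * G {1..CARD('n)} u v ^ i)) = K"
      by (intro ext) (simp only: K H P inner_G)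
    finally show ?thesis .
  qed
  have K_cont: "continuous_on UNIV (\<lambda>v. K u v)" "continuous_on UNIV (\<lambda>v. K v v)" for u
    unfolding K H P by (intro continuous_intros)+
  note K_borel = K_cont[THEN borel_measurable_continuous_onI]
  have emb: "kernel_embeddable K ip (data_measure N y)" for y :: "nat \<Rightarrow> real^'n"
    unfolding kernel_embeddable_def rkhs_norm_kernel
    using K_borel(2) by (intro data_measure_integral(2)) measurable
  define \<mu> where "\<mu> = data_measure N (\<lambda>i. proj (x i))"
  have "proj u \<in> span (e ` {1..k})" for u
    unfolding proj_def by (intro span_sum span_scale span_base) auto
  then have \<mu>_mem: "\<mu> \<in> {\<mu> \<in> subspace_measures k. kernel_embeddable K ip \<mu>}"
    unfolding \<mu>_def by (intro CollectI conjI emb data_measure_subspace[OF N])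
  have bdd: "bdd_below (d_MMD K ip (data_measure N x) `
      {\<mu> \<in> subspace_measures k. kernel_embeddable K ip \<mu>})"
  proof (rule bdd_belowI2)
    fix \<nu> assume \<nu>: "\<nu> \<in> {\<mu> \<in> subspace_measures k. kernel_embeddable K ip \<mu>}"
    have "kernel_embedding K (data_measure N x) \<in> F"
      by (rule kernel_embedding_mem[OF rk fk _ emb]) (simp add: data_measure_def)
    moreover have "kernel_embedding K \<nu> \<in> F"
      using \<nu> by (intro kernel_embedding_mem[OF rk fk]) (auto simp: subspace_measures_def)
    ultimately show "0 \<le> d_MMD K ip (data_measure N x) \<nu>"
      by (simp add: d_MMD_def rkhs_norm_def ip_nonneg diff_mem)
  qed
  \<comment> \<open>The kernel \<open>l (a - b) P(a) - (a P(a) - b P(b))\<close>.\<close>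
  define Q where "Q u v = real l * (G {k+1..CARD('n)} u v * H u v) - (K u v - K (proj u) (proj v))" for u v
  have "feature_kernel Q"
  proof -
    have "feature_kernel (\<lambda>u v. real l * ((u \<bullet> v - G {1..k} u v) * (\<Sum>i<l. c i * (u \<bullet> v) ^ i))
        - ((u \<bullet> v) * (\<Sum>i<l. c i * (u \<bullet> v) ^ i) - G {1..k} u v * (\<Sum>i<l. c i * G {1..k} u v ^ i)))"
    proof (intro feature_kernel_polynomial_tangent c)
      have "feature_kernel (G {1..CARD('n)})" by (rule G) simp
      also have "G {1..CARD('n)} = (\<bullet>)" by (intro ext) (rule inner_G[symmetric])
      finally show "feature_kernel ((\<bullet>) :: real^'n \<Rightarrow> real^'n \<Rightarrow> real)" .
      show "feature_kernel (G {1..k})" by (rule G) simp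
      have "feature_kernel (G {k+1..CARD('n)})" by (rule G) simp
      then show "feature_kernel (\<lambda>u v. u \<bullet> v - G {1..k} u v)" by (simp only: G_split)
    qed
    also have "(\<lambda>u v. real l * ((u \<bullet> v - G {1..k} u v) * (\<Sum>i<l. c i * (u \<bullet> v) ^ i))
        - ((u \<bullet> v) * (\<Sum>i<l. c i * (u \<bullet> v) ^ i) - G {1..k} u v * (\<Sum>i<l. c i * G {1..k} u v ^ i))) = Q"
      by (intro ext) (simp only: Q_def K H P inner_proj G_proj G_split)
    finally show ?thesis .
  qed
  then have "0 \<le> (\<Sum>i=1..N. \<Sum>j=1..N. Q (x i) (x j))"
    by (rule feature_kernel_double_sum_nonneg)
  then have gap: "(\<Sum>i=1..N. \<Sum>j=1..N. K (x i) (x j) - K (proj (x i)) (proj (x j))) \<le>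
      real l * (\<Sum>i=1..N. \<Sum>j=1..N. G {k+1..CARD('n)} (x i) (x j) * H (x i) (x j))"
    by (simp only: Q_def sum_subtractf sum_distrib_left diff_ge_0_iff_ge)
  have trace: "(\<Sum>i=1..N. \<Sum>j=1..N. G {k+1..CARD('n)} (x i) (x j) * H (x i) (x j)) / (real N)\<^sup>2
      = (\<Sum>r=k+1..CARD('n). lam r)"
  proof -
    have "lam r = (\<Sum>i=1..N. \<Sum>j=1..N. (x i \<bullet> e r) * (x j \<bullet> e r) * H (x i) (x j)) / (real N)\<^sup>2"
      if "r \<in> {k+1..CARD('n)}" for r
    proof -
      have r: "r \<in> {1..CARD('n)}" using that by auto
      then have "e r \<bullet> (H_matrix N x H *v e r) = lam r"
        using e orth[OF r r] by (simp add: orthonormal_eigenvectors_def)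
      then show ?thesis unfolding H_matrix_quadratic_form by (rule sym)
    qed
    then have "(\<Sum>r=k+1..CARD('n). lam r) = (\<Sum>r=k+1..CARD('n).
        (\<Sum>i=1..N. \<Sum>j=1..N. (x i \<bullet> e r) * (x j \<bullet> e r) * H (x i) (x j)) / (real N)\<^sup>2)"
      by (rule sum.cong[OF refl])
    also have "\<dots> = (\<Sum>r=k+1..CARD('n). \<Sum>i=1..N. \<Sum>j=1..N.
        (x i \<bullet> e r) * (x j \<bullet> e r) * H (x i) (x j)) / (real N)\<^sup>2"
      by (rule sum_divide_distrib[symmetric])
    also have "(\<Sum>r=k+1..CARD('n). \<Sum>i=1..N. \<Sum>j=1..N. (x i \<bullet> e r) * (x j \<bullet> e r) * H (x i) (x j))
        = (\<Sum>i=1..N. \<Sum>j=1..N. G {k+1..CARD('n)} (x i) (x j) * H (x i) (x j))"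
      unfolding G_def sum_distrib_right
      by (rule trans[OF sum.swap], rule sum.cong[OF refl], rule sum.swap)
    finally show ?thesis by simp
  qed
  \<comment> \<open>The cross terms and the term of the projected points all equal \<open>b P(b)\<close>; one copy survives.\<close>
  have "d_MMD K ip (data_measure N x) \<mu> =
      sqrt ((\<Sum>i=1..N. \<Sum>j=1..N. K (x i) (x j) - K (proj (x i)) (proj (x j))) / (real N)\<^sup>2)"
    unfolding \<mu>_def d_MMD_data_measures[OF rk K_borel(1)]
    by (simp add: K H proj_inner inner_proj G_proj del: One_nat_def)
  also have "\<dots> \<le> sqrt (real l * (\<Sum>r=k+1..CARD('n). lam r))"
    unfolding trace[symmetric] times_divide_eq_right
    using gap by (intro real_sqrt_le_mono divide_right_mono) auto
  also have "\<dots> = sqrt (real l) * sqrt (\<Sum>r=k+1..CARD('n). lam r)"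
    by (rule real_sqrt_mult)
  finally show ?thesis
    using cINF_lower[OF bdd \<mu>_mem] by linarith
qed

end
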